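(* Let $X$ be a normed space over $\mathbb{F}\in\{\mathbb{R},\mathbb{C}\}$ of dimension at least 2. Then numerical radius Birkhoff orthogonality in $\mathbb{B}(X)$ is neither additive on the left nor on the right. That is, there exist $T,S,R\in\mathbb{B}(X)$ with $T\perp_{vB}R$ and $S\perp_{vB}R$ but not $T+S\perp_{vB}R$; and there exist $T,S,R\in\mathbb{B}(X)$ with $T\perp_{vB}S$ and $T\perp_{vB}R$ but not $T\perp_{vB}S+R$.
   Context: $\mathbb{B}(X)$ is the space of bounded linear operators $X\to X$; $S_X$ is the unit sphere of $X$ and $S_{X^*}$ that of its dual $X^*$. For $x\in X$, $J(x)=\{x^*\in S_{X^*}: x^*(x)=\|x\|\}$. The numerical radius of $T\in\mathbb{B}(X)$ is $v(T)=\sup\{|x^*(Tx)|: x\in S_X,\ x^*\in J(x)\}$. $T$ is numerical radius Birkhoff orthogonal to $S$, written $T\perp_{vB}S$, if $v(T+\alpha S)\ge v(T)$ for all $\alpha\in\mathbb{F}$. *)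

theory Defs
  imports "HOL-Analysis.Analysis"
begin

text \<open>
  Normed spaces over a normed field \<open>'f\<close>, to be used with \<open>'f = real\<close> and \<open>'f = complex\<close>.
  The norm of \<open>'a\<close> is the one of its type class; the scalar multiplication is a parameter,
  since the distribution has no class of complex normed spaces. Completeness is not required.
\<close>

locale normed_vector_space = vector_space scale
  for scale :: "'f::real_normed_field \<Rightarrow> 'a::real_normed_vector \<Rightarrow> 'a" (infixr "\<cdot>" 75) +
  assumes norm_scale: "norm (c \<cdot> x) = norm c * norm x"
    and scale_of_real: "of_real r \<cdot> x = r *\<^sub>R x"
begin

text \<open>The library's \<^term>\<open>dim\<close> is \<open>0\<close> on infinite-dimensional spaces, so it cannot express a
  lower bound on the dimension.\<close>

definition dim_at_least :: "nat \<Rightarrow> bool" where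
  "dim_at_least n \<longleftrightarrow> (\<exists>B. independent B \<and> finite B \<and> card B = n)"

text \<open>\<^const>\<open>bounded_linear\<close> only speaks about real scalars; linearity over \<open>'f\<close> is added.\<close>

definition bounded_operators :: "('a \<Rightarrow> 'a) set" where
  "bounded_operators = {T. Vector_Spaces.linear scale scale T \<and> bounded_linear T}"

definition dual_space :: "('a \<Rightarrow> 'f) set" where
  "dual_space = {f. Vector_Spaces.linear scale (*) f \<and> bounded_linear f}"

definition support_functionals :: "'a \<Rightarrow> ('a \<Rightarrow> 'f) set" where
  "support_functionals x = {f \<in> dual_space. onorm f = 1 \<and> f x = of_real (norm x)}"

definition numerical_radius :: "('a \<Rightarrow> 'a) \<Rightarrow> real" where
  "numerical_radius T = Sup {norm (f (T x)) | x f. norm x = 1 \<and> f \<in> support_functionals x}"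

definition vB_orthogonal :: "('a \<Rightarrow> 'a) \<Rightarrow> ('a \<Rightarrow> 'a) \<Rightarrow> bool" where
  "vB_orthogonal T S \<longleftrightarrow>
     (\<forall>\<alpha>. numerical_radius (\<lambda>x. T x + \<alpha> \<cdot> S x) \<ge> numerical_radius T)"

end

lemma normed_vector_space_scaleR:
  "normed_vector_space ((*\<^sub>R) :: real \<Rightarrow> 'a::real_normed_vector \<Rightarrow> 'a)"
  by unfold_locales (simp_all add: algebra_simps)

lemma normed_vector_space_complex: "normed_vector_space ((*) :: complex \<Rightarrow> complex \<Rightarrow> complex)"
  by unfold_locales (simp_all add: algebra_simps norm_mult scaleR_conv_of_real)

end

theory Submission
  imports Defs
begin

text \<open>
  Let \<open>x\<close> be a unit vector, \<open>f\<close> a support functional at \<open>x\<close>, \<open>y\<close> a unit vector in the kernel of \<open>f\<close>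
  with support functional \<open>g\<close>, and let \<open>P z = f z \<cdot> x\<close>, a projection of norm one. Evaluating at
  \<open>(x, f)\<close> shows that both \<open>P\<close> and \<open>-I\<close>, which have numerical radius at most one, are orthogonal
  to \<open>I - P\<close>; but their sum \<open>P - I\<close> is not, as its numerical radius is positive by evaluation at
  \<open>(y, g)\<close>. Similarly \<open>I\<close> is orthogonal to \<open>P\<close> by \<open>(y, g)\<close> and to \<open>I - P\<close> by \<open>(x, f)\<close>, but not to
  their sum \<open>I\<close>.

  Support functionals come from the Hahn-Banach theorem, obtained here from the fact that a
  minimal sublinear functional is linear.
\<close>

section \<open>Support functionals\<close>

definition sublinear :: "('a::real_vector \<Rightarrow> real) \<Rightarrow> bool" where
  "sublinear p \<longleftrightarrow> (\<forall>x y. p (x + y) \<le> p x + p y) \<and> (\<forall>c\<ge>0. \<forall>x. p (c *\<^sub>R x) \<le> c * p x)"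

lemma sublinear_add: "sublinear p \<Longrightarrow> p (x + y) \<le> p x + p y"
  and sublinear_scale_le: "sublinear p \<Longrightarrow> c \<ge> 0 \<Longrightarrow> p (c *\<^sub>R x) \<le> c * p x"
  by (auto simp: sublinear_def)

lemma sublinear_0:
  assumes "sublinear p" shows "p 0 = 0"
  using sublinear_add[OF assms, of 0 0] sublinear_scale_le[OF assms, of 0 0] by simp

text \<open>The reverse inequality comes from scaling \<open>c *\<^sub>R x\<close> back by
  \<open>1 / c\<close>; this is why \<open>sublinear\<close> may ask for an inequality only.\<close>

lemma sublinear_scale:
  assumes "sublinear p" "c \<ge> 0" shows "p (c *\<^sub>R x) = c * p x"
proof (cases "c = 0")
  case False
  then have "c > 0" using assms by simp
  then have "p x \<le> p (c *\<^sub>R x) / c"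
    using sublinear_scale_le[OF assms(1), of "1 / c" "c *\<^sub>R x"] by simp
  with \<open>c > 0\<close> have "c * p x \<le> p (c *\<^sub>R x)" by (simp add: field_simps)
  with sublinear_scale_le[OF assms] show ?thesis by (metis antisym)
qed (simp add: sublinear_0 assms)

lemma sublinear_minus:
  assumes "sublinear p" shows "- p (- x) \<le> p x"
  using sublinear_add[OF assms, of x "- x"] sublinear_0[OF assms] by simp

lemma sublinear_norm: "sublinear norm"
  by (auto simp: sublinear_def norm_triangle_ineq)

text \<open>The largest sublinear functional below \<open>p\<close> whose value at \<open>-y\<close> is at most \<open>-p y\<close>.\<close>

definition lower_along :: "('a::real_vector \<Rightarrow> real) \<Rightarrow> 'a \<Rightarrow> 'a \<Rightarrow> real" where
  "lower_along p y x = (INF t\<in>{0..}. p (x + t *\<^sub>R y) - t * p y)"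

lemma lower_along_le:
  assumes "sublinear p" "t \<ge> 0"
  shows "lower_along p y x \<le> p (x + t *\<^sub>R y) - t * p y"
  unfolding lower_along_def
proof (rule cINF_lower)
  \<comment> \<open>The infimum is a genuine one: \<open>t * p y\<close> equals
    \<open>p (t *\<^sub>R y)\<close>, which is at most
    \<open>p (x + t *\<^sub>R y) + p (- x)\<close>, so \<open>- p (- x)\<close> is a lower bound
    independent of \<open>t\<close>.\<close>
  show "bdd_below ((\<lambda>t. p (x + t *\<^sub>R y) - t * p y) ` {0..})"
  proof (rule bdd_belowI2)
    fix t :: real assume "t \<in> {0..}"
    then show "- p (- x) \<le> p (x + t *\<^sub>R y) - t * p y"
      using sublinear_add[OF assms(1), of "x + t *\<^sub>R y" "- x"] sublinear_scale[OF assms(1), of t y]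
      by simp
  qed
qed (use assms in simp)

lemma lower_along_greatest:
  assumes "\<And>t. t \<ge> 0 \<Longrightarrow> a \<le> p (x + t *\<^sub>R y) - t * p y"
  shows "a \<le> lower_along p y x"
  unfolding lower_along_def by (rule cINF_greatest) (use assms in auto)

lemma lower_along_le_self: "sublinear p \<Longrightarrow> lower_along p y x \<le> p x"
  using lower_along_le[of p 0 y x] by simp

lemma lower_along_minus: "sublinear p \<Longrightarrow> lower_along p y (- y) \<le> - p y"
  using lower_along_le[of p 1 y "- y"] by (simp add: sublinear_0)

lemma sublinear_lower_along:
  assumes p: "sublinear p" shows "sublinear (lower_along p y)"
  unfolding sublinear_def
proof (intro conjI allI impI)
  fix x z
  \<comment> \<open>Parameters \<open>s\<close> for \<open>x\<close> and \<open>t\<close> for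
    \<open>z\<close> combine to the parameter \<open>s + t\<close> for \<open>x + z\<close>. The
    infimum is then taken over \<open>t\<close> first and over \<open>s\<close> afterwards.\<close>
  have "lower_along p y (x + z) - (p (x + s *\<^sub>R y) - s * p y) \<le> p (z + t *\<^sub>R y) - t * p y"
    if "s \<ge> 0" "t \<ge> 0" for s t
    using lower_along_le[OF p, of "s + t" y "x + z"] that
      sublinear_add[OF p, of "x + s *\<^sub>R y" "z + t *\<^sub>R y"]
    by (simp add: algebra_simps)
  then have "lower_along p y (x + z) - (p (x + s *\<^sub>R y) - s * p y) \<le> lower_along p y z"
    if "s \<ge> 0" for s
    using that lower_along_greatest by blast
  then have "lower_along p y (x + z) - lower_along p y z \<le> lower_along p y x"
    by (intro lower_along_greatest) (simp add: algebra_simps)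
  then show "lower_along p y (x + z) \<le> lower_along p y x + lower_along p y z" by simp
next
  fix c :: real and x assume "c \<ge> 0"
  show "lower_along p y (c *\<^sub>R x) \<le> c * lower_along p y x"
  proof (cases "c = 0")
    case True
    then show ?thesis using lower_along_le_self[OF p, of y 0] by (simp add: sublinear_0 p)
  next
    case False
    with \<open>c \<ge> 0\<close> have "c > 0" by simp
    \<comment> \<open>The parameter \<open>t\<close> at \<open>x\<close> corresponds to
      \<open>c * t\<close> at \<open>c *\<^sub>R x\<close>.\<close>
    have "lower_along p y (c *\<^sub>R x) / c \<le> p (x + t *\<^sub>R y) - t * p y" if "t \<ge> 0" for t
    proof -
      have "lower_along p y (c *\<^sub>R x) \<le> p (c *\<^sub>R (x + t *\<^sub>R y)) - (c * t) * p y"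
        using lower_along_le[OF p, of "c * t" y "c *\<^sub>R x"] that \<open>c > 0\<close>
        by (simp add: algebra_simps)
      also have "\<dots> = c * (p (x + t *\<^sub>R y) - t * p y)"
        using sublinear_scale[OF p, of c "x + t *\<^sub>R y"] \<open>c > 0\<close>
        by (simp add: right_diff_distrib)
      finally show ?thesis using \<open>c > 0\<close> by (simp add: field_simps)
    qed
    then have "lower_along p y (c *\<^sub>R x) / c \<le> lower_along p y x"
      by (rule lower_along_greatest)
    with \<open>c > 0\<close> show ?thesis by (simp add: field_simps)
  qed
qed

text \<open>Lowering \<open>p\<close> along \<open>y\<close> gives a sublinear functional below
  \<open>p\<close>, so by minimality nothing changes. The parameter \<open>t = 1\<close> then yields
  the inequality opposite to subadditivity.\<close>

lemma minimal_sublinear_additive: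
  assumes p: "sublinear p" and min: "\<And>q. sublinear q \<Longrightarrow> q \<le> p \<Longrightarrow> q = p"
  shows "p (x + y) = p x + p y"
proof -
  have "lower_along p y = p"
    by (rule min[OF sublinear_lower_along[OF p] le_funI[OF lower_along_le_self[OF p]]])
  then have "p x \<le> p (x + y) - p y" using lower_along_le[OF p, of 1 y x] by simp
  with sublinear_add[OF p, of x y] show ?thesis by simp
qed

text \<open>The pointwise infimum works. It is finite because \<open>- q (- x)\<close> bounds all
  values at \<open>x\<close> from below, and it stays subadditive because of any two members of a
  chain one lies below both.\<close>

lemma sublinear_chain_Inf:
  assumes "C \<noteq> {}" and sub: "\<And>p. p \<in> C \<Longrightarrow> sublinear p" and le: "\<And>p. p \<in> C \<Longrightarrow> p \<le> q"
    and chain: "\<And>p r. p \<in> C \<Longrightarrow> r \<in> C \<Longrightarrow> p \<le> r \<or> r \<le> p"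
  shows "\<exists>u. sublinear u \<and> (\<forall>p\<in>C. u \<le> p)"
proof -
  define u where "u x = (INF p\<in>C. p x)" for x
  have lower: "u x \<le> p x" if "p \<in> C" for p x
    unfolding u_def
  proof (rule cINF_lower[OF bdd_belowI2 that])
    fix r assume "r \<in> C"
    then show "- q (- x) \<le> r x"
      using sublinear_minus[OF sub, of r x] le_funD[OF le, of r "- x"] by simp
  qed
  have greatest: "a \<le> u x" if "\<And>p. p \<in> C \<Longrightarrow> a \<le> p x" for a x
    unfolding u_def using \<open>C \<noteq> {}\<close> that by (rule cINF_greatest)
  have "sublinear u"
    unfolding sublinear_def
  proof (intro conjI allI impI)
    fix x y
    have "u (x + y) - p x \<le> r y" if pr: "p \<in> C" "r \<in> C" for p r
    proof -
      obtain m where m: "m \<in> C" "m \<le> p" "m \<le> r"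
        using chain[OF pr] pr by blast
      have "u (x + y) \<le> m x + m y"
        using lower[OF m(1), of "x + y"] sublinear_add[OF sub[OF m(1)], of x y] by simp
      also have "\<dots> \<le> p x + r y" by (intro add_mono le_funD[OF m(2)] le_funD[OF m(3)])
      finally show ?thesis by simp
    qed
    then have "u (x + y) - p x \<le> u y" if "p \<in> C" for p
      using that greatest by blast
    then have "u (x + y) - u y \<le> u x"
      by (intro greatest) (simp add: algebra_simps)
    then show "u (x + y) \<le> u x + u y" by simp
  next
    fix c :: real and x assume "c \<ge> 0"
    show "u (c *\<^sub>R x) \<le> c * u x"
    proof (cases "c = 0")
      case True
      obtain p where "p \<in> C" using \<open>C \<noteq> {}\<close> by blast
      then show ?thesis using True lower[of p 0] sublinear_0[OF sub, of p] by simp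
    next
      case False
      with \<open>c \<ge> 0\<close> have "c > 0" by simp
      have "u (c *\<^sub>R x) / c \<le> u x"
      proof (rule greatest)
        fix p assume "p \<in> C"
        then show "u (c *\<^sub>R x) / c \<le> p x"
          using lower[of p "c *\<^sub>R x"] sublinear_scale[OF sub, of p c x] \<open>c > 0\<close>
          by (simp add: field_simps)
      qed
      with \<open>c > 0\<close> show ?thesis by (simp add: field_simps)
    qed
  qed
  with lower show ?thesis by (auto simp: le_fun_def)
qed

lemma ex_minimal_sublinear:
  assumes q: "sublinear q"
  shows "\<exists>p. sublinear p \<and> p \<le> q \<and> (\<forall>r. sublinear r \<longrightarrow> r \<le> p \<longrightarrow> r = p)"
proof -
  define A where "A = {p. sublinear p \<and> p \<le> q}"
  have "\<exists>m\<in>A. \<forall>a\<in>A. a \<le> m \<longrightarrow> a = m"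
  \<comment> \<open>Zorn's lemma is used for the reversed pointwise order: upper bounds of chains
    become lower bounds, and a maximal element becomes a minimal functional.\<close>
  proof (rule predicate_Zorn)
    show "partial_order_on A (relation_of (\<lambda>a b. b \<le> a) A)"
      by (rule partial_order_on_relation_ofI) auto
  next
    fix C assume "C \<in> Chains (relation_of (\<lambda>a b. b \<le> a) A)"
    then have C: "C \<subseteq> A" "\<And>p r. p \<in> C \<Longrightarrow> r \<in> C \<Longrightarrow> p \<le> r \<or> r \<le> p"
      by (auto simp: Chains_def relation_of_def)
    show "\<exists>u\<in>A. \<forall>a\<in>C. u \<le> a"
    proof (cases "C = {}")
      case True
      then show ?thesis using q by (auto simp: A_def)
    next
      case False
      obtain u where u: "sublinear u" "\<forall>p\<in>C. u \<le> p"
        using sublinear_chain_Inf[OF False, of q] C by (auto simp: A_def)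
      moreover have "u \<le> q" using False u(2) C(1) by (force simp: A_def)
      ultimately show ?thesis by (auto simp: A_def)
    qed
  qed
  then obtain m where m: "m \<in> A" "\<And>a. a \<in> A \<Longrightarrow> a \<le> m \<Longrightarrow> a = m" by blast
  show ?thesis
  proof (intro exI conjI allI impI)
    show *: "sublinear m" "m \<le> q" using m(1) by (simp_all add: A_def)
    show "r = m" if "sublinear r" "r \<le> m" for r
      using m that order_trans[OF \<open>r \<le> m\<close> *(2)] by (simp add: A_def)
  qed
qed

text \<open>A minimal functional below the norm alone would be linear but need not norm
  \<open>x\<close>. Starting instead from \<open>lower_along norm x\<close> forces
  \<open>g (- x) \<le> - norm x\<close>, hence \<open>g x = norm x\<close>.\<close>

lemma real_support_functional:
  fixes x :: "'a::real_normed_vector"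
  obtains g :: "'a \<Rightarrow> real" where "linear g" "g x = norm x" "\<And>z. \<bar>g z\<bar> \<le> norm z"
proof -
  let ?q = "lower_along norm x"
  obtain g where "sublinear g \<and> g \<le> ?q \<and> (\<forall>r. sublinear r \<longrightarrow> r \<le> g \<longrightarrow> r = g)"
    using ex_minimal_sublinear[OF sublinear_lower_along[OF sublinear_norm, of x]] by (rule exE)
  then have g: "sublinear g" "g \<le> ?q" and min: "\<forall>r. sublinear r \<longrightarrow> r \<le> g \<longrightarrow> r = g"
    by simp_all
  have add: "g (a + b) = g a + g b" for a b
    by (rule minimal_sublinear_additive[OF g(1) min[rule_format]])
  have minus: "g (- a) = - g a" for a
    using add[of a "- a"] sublinear_0[OF g(1)] by simp
  have scale: "g (c *\<^sub>R a) = c * g a" for c a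
    using sublinear_scale[OF g(1), of c a] sublinear_scale[OF g(1), of "- c" a] minus[of "c *\<^sub>R a"]
    by (cases "c \<ge> 0") auto
  have le: "g a \<le> norm a" for a
    using le_funD[OF g(2), of a] lower_along_le_self[OF sublinear_norm, of x a] by simp
  show ?thesis
  proof
    show "linear g" by (rule linearI) (simp_all add: add scale)
    show "g x = norm x"
      using le[of x] le_funD[OF g(2), of "- x"] lower_along_minus[OF sublinear_norm, of x] minus[of x]
      by simp
    show "\<bar>g z\<bar> \<le> norm z" for z using le[of z] le[of "- z"] minus[of z] by simp
  qed
qed

section \<open>Support functionals over the real and the complex scalars\<close>

context normed_vector_space
begin

text \<open>The operator norm is exactly one because the bound \<open>le\<close> is attained at the
  unit vector \<open>x\<close>. Real homogeneity is the case of scalars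
  \<open>of_real r\<close>.\<close>

lemma support_functionalsI:
  assumes add: "\<And>a b. f (a + b) = f a + f b" and scale: "\<And>c a. f (c \<cdot> a) = c * f a"
    and le: "\<And>a. norm (f a) \<le> norm a" and "norm x = 1" "f x = 1"
  shows "f \<in> support_functionals x"
proof -
  have bl: "bounded_linear f"
  proof (rule bounded_linear_intro)
    show "f (r *\<^sub>R a) = r *\<^sub>R f a" for r a
      using scale[of "of_real r" a] by (simp add: scale_of_real scaleR_conv_of_real)
    show "norm (f a) \<le> norm a * 1" for a using le by simp
  qed (rule add)
  \<comment> \<open>\<open>Vector_Spaces.linear\<close> includes the claim that domain and codomain
    are vector spaces; here the codomain is the field acting on itself.\<close>
  have "vector_space ((*) :: 'f \<Rightarrow> 'f \<Rightarrow> 'f)"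
    by unfold_locales (simp_all add: algebra_simps)
  then have "Vector_Spaces.linear scale (*) f"
    using add scale vector_space_axioms by (simp add: Vector_Spaces.linear_iff)
  moreover have "onorm f = 1"
  proof (rule antisym)
    show "onorm f \<le> 1" by (rule onorm_bound) (simp_all add: le)
    show "1 \<le> onorm f" using onorm[OF bl, of x] \<open>norm x = 1\<close> \<open>f x = 1\<close> by simp
  qed
  ultimately show ?thesis
    using bl \<open>norm x = 1\<close> \<open>f x = 1\<close> by (simp add: support_functionals_def dual_space_def)
qed

lemma support_functionalsD:
  assumes "f \<in> support_functionals x"
  shows "f (a + b) = f a + f b" "f (c \<cdot> a) = c * f a" "norm (f a) \<le> norm a"
    "f x = of_real (norm x)" "bounded_linear f"
proof -
  have bl: "bounded_linear f" and "onorm f = 1" and lin: "Vector_Spaces.linear scale (*) f"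
    using assms by (auto simp: support_functionals_def dual_space_def)
  then show "norm (f a) \<le> norm a" using onorm[OF bl, of a] by simp
  show "f (a + b) = f a + f b" "f (c \<cdot> a) = c * f a"
    using lin by (simp_all add: Vector_Spaces.linear_iff)
  show "f x = of_real (norm x)" using assms by (simp add: support_functionals_def)
qed (use assms in \<open>simp add: support_functionals_def dual_space_def\<close>)

end

lemma ex_support_functional_real:
  fixes scale :: "real \<Rightarrow> 'a::real_normed_vector \<Rightarrow> 'a"
  assumes "normed_vector_space scale" "norm x = 1"
  shows "normed_vector_space.support_functionals scale x \<noteq> {}"
proof -
  interpret normed_vector_space scale by fact
  obtain g where g: "linear g" "g x = norm x" "\<And>z. \<bar>g z\<bar> \<le> norm z"
    using real_support_functional by blast
  have "scale r z = r *\<^sub>R z" for r z using scale_of_real[of r z] by simp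
  then have "g \<in> support_functionals x"
    using g \<open>norm x = 1\<close>
    by (intro support_functionalsI) (auto simp: linear_add linear_scale)
  then show ?thesis by blast
qed

text \<open>The usual complexification: a real linear \<open>g\<close> is the real part of the
  complex linear functional sending \<open>z\<close> to
  \<open>g z - \<i> * g (\<i> \<cdot> z)\<close>.\<close>

lemma ex_support_functional_complex:
  fixes scale :: "complex \<Rightarrow> 'a::real_normed_vector \<Rightarrow> 'a" (infixr "\<cdot>" 75)
  assumes "normed_vector_space scale" "norm x = 1"
  shows "normed_vector_space.support_functionals scale x \<noteq> {}"
proof -
  interpret normed_vector_space scale by fact
  obtain g where g: "linear g" "g x = norm x" "\<And>z. \<bar>g z\<bar> \<le> norm z"
    using real_support_functional by blast
  define f where "f z = Complex (g z) (- g (\<i> \<cdot> z))" for z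
  have add: "f (a + b) = f a + f b" for a b
    by (simp add: f_def complex_eq_iff linear_add[OF g(1)] scale_right_distrib)
  have scale: "f (c \<cdot> a) = c * f a" for c a
  proof -
    \<comment> \<open>Multiplication by \<open>c\<close> is a real combination of the identity and
      multiplication by \<open>\<i>\<close>, so the real linearity of \<open>g\<close>
      suffices.\<close>
    have c: "c \<cdot> b = Re c *\<^sub>R b + Im c *\<^sub>R (\<i> \<cdot> b)" for b
    proof -
      have "c = of_real (Re c) + of_real (Im c) * \<i>" by (simp add: complex_eq_iff)
      then have "c \<cdot> b = (of_real (Re c) + of_real (Im c) * \<i>) \<cdot> b" by (rule arg_cong)
      also have "\<dots> = of_real (Re c) \<cdot> b + of_real (Im c) \<cdot> \<i> \<cdot> b"
        by (simp only: scale_left_distrib scale_scale)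
      finally show ?thesis by (simp only: scale_of_real)
    qed
    have "\<i> \<cdot> c \<cdot> a = c \<cdot> \<i> \<cdot> a" by (simp only: scale_scale mult.commute)
    moreover have "\<i> \<cdot> \<i> \<cdot> a = - a" by (simp add: scale_minus_left)
    ultimately have "g (c \<cdot> a) = Re c * g a + Im c * g (\<i> \<cdot> a)"
      "g (\<i> \<cdot> c \<cdot> a) = Re c * g (\<i> \<cdot> a) - Im c * g a"
      unfolding c[of a] c[of "\<i> \<cdot> a"]
      by (simp_all only: linear_add[OF g(1)] linear_scale[OF g(1)] linear_neg[OF g(1)]
          scale_minus_right real_scaleR_def)
    then show ?thesis by (simp add: f_def complex_eq_iff)
  qed
  \<comment> \<open>Rotating \<open>z\<close> so that \<open>f z\<close> becomes real reduces the bound for \<open>f\<close> to that for \<open>g = Re f\<close>.\<close>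
  have le: "norm (f z) \<le> norm z" for z
  proof (cases "f z = 0")
    case False
    define w where "w = cnj (sgn (f z))"
    have "norm w = 1" using False by (simp add: w_def norm_sgn)
    have "f (w \<cdot> z) = of_real (norm (f z))"
      using False complex_norm_square[of "f z"]
      by (simp add: scale w_def sgn_div_norm scaleR_conv_of_real field_simps power2_eq_square)
    then have "norm (f z) = g (w \<cdot> z)" by (simp add: f_def complex_eq_iff)
    also have "\<dots> \<le> norm (w \<cdot> z)" using g(3)[of "w \<cdot> z"] by simp
    finally show ?thesis using \<open>norm w = 1\<close> by (simp add: norm_scale)
  qed simp
  \<comment> \<open>A complex number of modulus at most one with real part one has no imaginary
    part.\<close>
  have "norm (f x) \<ge> 1" "Re (f x) = 1" using g(2) \<open>norm x = 1\<close> complex_Re_le_cmod[of "f x"]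
    by (auto simp: f_def)
  moreover have "norm (f x) \<le> 1" using le[of x] \<open>norm x = 1\<close> by simp
  ultimately have "f x = 1"
    by (simp add: complex_eq_iff cmod_def real_sqrt_le_1_iff)
  with add scale le \<open>norm x = 1\<close> have "f \<in> support_functionals x"
    by (intro support_functionalsI)
  then show ?thesis by blast
qed

section \<open>Failure of additivity\<close>

context normed_vector_space
begin

lemma bounded_operatorsI:
  assumes "\<And>a b. T (a + b) = T a + T b" "\<And>c a. T (c \<cdot> a) = c \<cdot> T a"
    and "\<And>a. norm (T a) \<le> norm a * K"
  shows "T \<in> bounded_operators"
proof -
  have "bounded_linear T"
  proof (rule bounded_linear_intro)
    show "T (r *\<^sub>R a) = r *\<^sub>R T a" for r a
      using assms(2)[of "of_real r" a] by (simp add: scale_of_real)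
  qed (use assms in auto)
  then show ?thesis
    using assms vector_space_axioms by (simp add: bounded_operators_def Vector_Spaces.linear_iff)
qed

lemma bounded_operatorsD:
  assumes "T \<in> bounded_operators"
  shows "T (a + b) = T a + T b" "T (c \<cdot> a) = c \<cdot> T a" "bounded_linear T"
  using assms by (simp_all add: bounded_operators_def Vector_Spaces.linear_iff)

lemma bounded_operators_combination:
  assumes "T \<in> bounded_operators" "S \<in> bounded_operators"
  shows "(\<lambda>x. T x + c \<cdot> S x) \<in> bounded_operators"
proof (rule bounded_operatorsI)
  note T = bounded_operatorsD[OF assms(1)] and S = bounded_operatorsD[OF assms(2)]
  show "T (a + b) + c \<cdot> S (a + b) = (T a + c \<cdot> S a) + (T b + c \<cdot> S b)" for a b
    by (simp add: T S scale_right_distrib)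
  show "T (d \<cdot> a) + c \<cdot> S (d \<cdot> a) = d \<cdot> (T a + c \<cdot> S a)" for d a
    by (simp add: T S scale_right_distrib mult.commute)
  show "norm (T a + c \<cdot> S a) \<le> norm a * (onorm T + norm c * onorm S)" for a
    using norm_triangle_ineq[of "T a" "c \<cdot> S a"] onorm[OF T(3), of a]
      mult_left_mono[OF onorm[OF S(3), of a] norm_ge_zero[of c]]
    by (simp add: norm_scale algebra_simps)
qed

lemma bounded_operators_id: "(\<lambda>x. x) \<in> bounded_operators"
  by (rule bounded_operatorsI[where K = 1]) auto

lemma bounded_operators_minus:
  assumes "T \<in> bounded_operators"
  shows "(\<lambda>x. - T x) \<in> bounded_operators"
  \<comment> \<open>The negative is written as \<open>T x + (- 2) \<cdot> T x\<close>.\<close>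
  using bounded_operators_combination[OF assms assms, of "- 2"]
    scale_left_diff_distrib[of 1 2] by (simp add: scale_left_distrib[symmetric])

lemma numerical_radius_ge:
  assumes "T \<in> bounded_operators" "norm x = 1" "f \<in> support_functionals x"
  shows "norm (f (T x)) \<le> numerical_radius T"
  unfolding numerical_radius_def
proof (rule cSup_upper)
  \<comment> \<open>The operator norm bounds the numerical range, so the supremum really is an upper
    bound.\<close>
  show "bdd_above {norm (f (T x)) |x f. norm x = 1 \<and> f \<in> support_functionals x}"
  proof (rule bdd_aboveI, clarify)
    fix x f assume "norm x = 1" "f \<in> support_functionals x"
    then show "norm (f (T x)) \<le> onorm T"
      using support_functionalsD(3)[of f x "T x"] onorm[OF bounded_operatorsD(3)[OF assms(1)], of x]
      by simp
  qed
qed (use assms in blast)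

text \<open>The first two assumptions exclude the supremum of the empty set.\<close>

lemma numerical_radius_le:
  assumes "norm x = 1" "f \<in> support_functionals x" and le: "\<And>a. norm (T a) \<le> c * norm a"
  shows "numerical_radius T \<le> c"
  unfolding numerical_radius_def
proof (rule cSup_least)
  fix r assume "r \<in> {norm (f (T x)) |x f. norm x = 1 \<and> f \<in> support_functionals x}"
  then obtain z h where "r = norm (h (T z))" "norm z = 1" "h \<in> support_functionals z" by blast
  then show "r \<le> c"
    using support_functionalsD(3)[of h z "T z"] le[of z] by simp
qed (use assms in blast)

lemma sgn_eq_scale: "sgn a = of_real (inverse (norm a)) \<cdot> a"
  by (simp only: sgn_div_norm scale_of_real)

text \<open>Take \<open>f\<close> supporting the normalised first of two independent vectors, and
  remove from the second its component along the first. The remainder lies in the kernel of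
  \<open>f\<close> and is nonzero by independence. Existence of support functionals is assumed so
  that one argument serves both scalar fields.\<close>

lemma ex_support_functional_kernel:
  assumes "dim_at_least 2" and ex: "\<And>x. norm x = 1 \<Longrightarrow> support_functionals x \<noteq> {}"
  obtains x y f where "norm x = 1" "f \<in> support_functionals x" "norm y = 1" "f y = 0"
proof -
  obtain a b where ab: "independent {a, b}" "a \<noteq> b"
    using assms(1) by (auto simp: dim_at_least_def card_2_iff)
  then have b: "b \<notin> span {a}" and "a \<noteq> 0"
    using independent_insert[of b "{a}"] dependent_zero[of "{a, b}"] by (auto simp: insert_commute)
  then have "norm (sgn a) = 1" by (simp add: norm_sgn)
  then obtain f where f: "f \<in> support_functionals (sgn a)" using ex by blast
  note fD = support_functionalsD[OF f]
  define w where "w = b - f b \<cdot> sgn a"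
  have "w \<noteq> 0"
  proof
    assume "w = 0"
    then have "b = f b \<cdot> sgn a" by (simp add: w_def)
    moreover have "f b \<cdot> sgn a \<in> span {a}"
      unfolding sgn_eq_scale by (intro span_scale span_base) simp
    ultimately show False using b by simp
  qed
  have "f b = f w + f (f b \<cdot> sgn a)" using fD(1)[of w "f b \<cdot> sgn a"] by (simp add: w_def)
  then have "f w = 0" using \<open>norm (sgn a) = 1\<close> by (simp add: fD(2,4))
  then have "f (sgn w) = 0" by (simp only: sgn_eq_scale fD(2) mult_zero_right)
  with \<open>w \<noteq> 0\<close> \<open>norm (sgn a) = 1\<close> f show ?thesis by (intro that[of "sgn a" f "sgn w"]) (auto simp: norm_sgn)
qed

section \<open>The counterexamples on both sides\<close>

lemma vB_orthogonal_not_additive: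
  assumes "dim_at_least 2" and ex: "\<And>x. norm x = 1 \<Longrightarrow> support_functionals x \<noteq> {}"
  shows "(\<exists>T\<in>bounded_operators. \<exists>S\<in>bounded_operators. \<exists>R\<in>bounded_operators.
      vB_orthogonal T R \<and> vB_orthogonal S R \<and> \<not> vB_orthogonal (\<lambda>x. T x + S x) R)" (is ?left)
    and "(\<exists>T\<in>bounded_operators. \<exists>S\<in>bounded_operators. \<exists>R\<in>bounded_operators.
      vB_orthogonal T S \<and> vB_orthogonal T R \<and> \<not> vB_orthogonal T (\<lambda>x. S x + R x))" (is ?right)
proof -
  obtain x y f where x: "norm x = 1" and f: "f \<in> support_functionals x"
    and y: "norm y = 1" and "f y = 0"
    using ex_support_functional_kernel[OF assms] by blast
  obtain g where g: "g \<in> support_functionals y" using ex[OF y] by blast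
  note fD = support_functionalsD[OF f] and gD = support_functionalsD[OF g]
  define P where "P z = f z \<cdot> x" for z
  have norm_P: "norm (P z) \<le> norm z" for z
    by (simp add: P_def norm_scale x fD)
  have P: "P \<in> bounded_operators"
    by (rule bounded_operatorsI[where K = 1])
      (use norm_P in \<open>simp_all add: P_def fD scale_left_distrib\<close>)
  have [simp]: "P x = x" "P y = 0" "f x = 1" "g y = 1"
    using \<open>f y = 0\<close> x y fD(4) gD(4) by (simp_all add: P_def)
  have [simp]: "f (- z) = - f z" "g (- z) = - g z" for z
    using fD(5) gD(5) by (simp_all add: linear_neg bounded_linear.linear)
  note I = bounded_operators_id and comb = bounded_operators_combination
  have Q: "(\<lambda>z. z - P z) \<in> bounded_operators"
    using comb[OF I P, of "- 1"] by simp
  have mI: "(\<lambda>z. - z) \<in> bounded_operators" using bounded_operators_minus[OF I] .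
  have PmI: "(\<lambda>z. P z + - z) \<in> bounded_operators" using comb[OF P mI, of 1] by simp
  \<comment> \<open>Since \<open>S u = 0\<close>, adding a multiple of \<open>S\<close> leaves the
    value of modulus one at \<open>(u, h)\<close> unchanged, so the numerical radius cannot drop
    below one, while that of the contraction \<open>T\<close> is at most one.\<close>
  have orthoI: "vB_orthogonal T S"
    if "T \<in> bounded_operators" "S \<in> bounded_operators" "\<And>z. norm (T z) \<le> norm z"
      "norm u = 1" "h \<in> support_functionals u" "norm (h (T u)) = 1" "S u = 0" for T S u h
    unfolding vB_orthogonal_def
  proof
    fix \<alpha>
    have "numerical_radius T \<le> 1"
      using numerical_radius_le[OF x f, of T 1] that(3) by simp
    also have "1 \<le> numerical_radius (\<lambda>x. T x + \<alpha> \<cdot> S x)"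
      using numerical_radius_ge[OF comb[OF that(1,2)] that(4,5), of \<alpha>] that(6,7) by simp
    finally show "numerical_radius T \<le> numerical_radius (\<lambda>x. T x + \<alpha> \<cdot> S x)" .
  qed
  \<comment> \<open>If some multiple of \<open>S\<close> cancels \<open>T\<close>, the numerical
    radius drops to zero, although that of \<open>T\<close> is at least one by evaluation at
    \<open>(y, g)\<close>.\<close>
  have not_ortho: "\<not> vB_orthogonal T S"
    if "T \<in> bounded_operators" "norm (g (T y)) = 1" "\<And>z. T z + \<alpha> \<cdot> S z = 0" for T S \<alpha>
  proof
    assume "vB_orthogonal T S"
    then have "numerical_radius T \<le> numerical_radius (\<lambda>x. T x + \<alpha> \<cdot> S x)"
      by (simp add: vB_orthogonal_def)
    moreover have "numerical_radius (\<lambda>x. T x + \<alpha> \<cdot> S x) \<le> 0"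
      by (rule numerical_radius_le[OF x f]) (simp add: that(3))
    ultimately show False using numerical_radius_ge[OF that(1) y g] that(2) by simp
  qed
  show ?left
  proof (intro bexI conjI)
    show "vB_orthogonal P (\<lambda>z. z - P z)" by (rule orthoI[OF P Q _ x f]) (simp_all add: norm_P)
    show "vB_orthogonal (\<lambda>z. - z) (\<lambda>z. z - P z)" by (rule orthoI[OF mI Q _ x f]) simp_all
    \<comment> \<open>The sum is the negative of \<open>R\<close>, so the scalar one cancels it; at
      \<open>y\<close> it takes the value \<open>- y\<close>.\<close>
    show "\<not> vB_orthogonal (\<lambda>z. P z + - z) (\<lambda>z. z - P z)"
      by (rule not_ortho[where \<alpha> = 1, OF PmI]) simp_all
  qed (fact P mI Q)+
  show ?right
  proof (intro bexI conjI)
    show "vB_orthogonal (\<lambda>z. z) P" by (rule orthoI[OF I P _ y g]) simp_all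
    show "vB_orthogonal (\<lambda>z. z) (\<lambda>z. z - P z)" by (rule orthoI[OF I Q _ x f]) simp_all
    \<comment> \<open>The two summands add up to the identity, which the scalar \<open>- 1\<close>
      cancels.\<close>
    show "\<not> vB_orthogonal (\<lambda>z. z) (\<lambda>z. P z + (z - P z))"
      by (rule not_ortho[where \<alpha> = "- 1", OF I]) simp_all
  qed (fact I P Q)+
qed

end

theorem theorem22:
  fixes scaleX :: "real \<Rightarrow> 'a::real_normed_vector \<Rightarrow> 'a"
    and scaleY :: "complex \<Rightarrow> 'b::real_normed_vector \<Rightarrow> 'b"
  shows
    "(normed_vector_space scaleX \<and> normed_vector_space.dim_at_least scaleX 2 \<longrightarrow>
      (\<exists>T \<in> normed_vector_space.bounded_operators scaleX.
        \<exists>S \<in> normed_vector_space.bounded_operators scaleX.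
        \<exists>R \<in> normed_vector_space.bounded_operators scaleX.
          normed_vector_space.vB_orthogonal scaleX T R \<and>
          normed_vector_space.vB_orthogonal scaleX S R \<and>
          \<not> normed_vector_space.vB_orthogonal scaleX (\<lambda>x. T x + S x) R) \<and>
      (\<exists>T \<in> normed_vector_space.bounded_operators scaleX.
        \<exists>S \<in> normed_vector_space.bounded_operators scaleX.
        \<exists>R \<in> normed_vector_space.bounded_operators scaleX.
          normed_vector_space.vB_orthogonal scaleX T S \<and>
          normed_vector_space.vB_orthogonal scaleX T R \<and>
          \<not> normed_vector_space.vB_orthogonal scaleX T (\<lambda>x. S x + R x)))
    \<and>
    (normed_vector_space scaleY \<and> normed_vector_space.dim_at_least scaleY 2 \<longrightarrow>
      (\<exists>T \<in> normed_vector_space.bounded_operators scaleY.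
        \<exists>S \<in> normed_vector_space.bounded_operators scaleY.
        \<exists>R \<in> normed_vector_space.bounded_operators scaleY.
          normed_vector_space.vB_orthogonal scaleY T R \<and>
          normed_vector_space.vB_orthogonal scaleY S R \<and>
          \<not> normed_vector_space.vB_orthogonal scaleY (\<lambda>x. T x + S x) R) \<and>
      (\<exists>T \<in> normed_vector_space.bounded_operators scaleY.
        \<exists>S \<in> normed_vector_space.bounded_operators scaleY.
        \<exists>R \<in> normed_vector_space.bounded_operators scaleY.
          normed_vector_space.vB_orthogonal scaleY T S \<and>
          normed_vector_space.vB_orthogonal scaleY T R \<and>
          \<not> normed_vector_space.vB_orthogonal scaleY T (\<lambda>x. S x + R x)))"
  using normed_vector_space.vB_orthogonal_not_additive[of scaleX]
    normed_vector_space.vB_orthogonal_not_additive[of scaleY]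
    ex_support_functional_real[of scaleX] ex_support_functional_complex[of scaleY]
  by (intro conjI impI) (elim conjE, simp)+

end
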